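(* Let $H=\overline{P_2 \cup P_3}$. Let $G$ be a simple graph that contains no subgraph isomorphic to $H$, such that $G \to (3,3)^e$, and such that $G$ is minimal, i.e. for every edge $e \in E(G)$ we have $G - e \not\to (3,3)^e$. Then: \begin{enumerate} \item $G$ is $K_4$-free. \item Each edge of $G$ belongs to at least two triangles. Equivalently, for any vertex $u \in V(G)$, every vertex $v$ of $G[N(u)]$ has degree at least $2$ within $G[N(u)]$. \item For any vertex $u \in V(G)$, $G[N(u)]$ is $K_3$-free and $C_4$-free. \item For any vertex $u \in V(G)$ and each edge $e$ of $G[N(u)]$, there exists a vertex $v \in X = V(G) \setminus (N(u) \cup \{u\})$ adjacent to both endpoints of $e$. Moreover, for any two distinct edges of $G[N(u)]$, the corresponding vertices $v \in X$ are distinct. \item Every vertex $u \in V(G)$ has degree at least $8$. \end{enumerate}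
   Context: All graphs are finite, simple and undirected. $P_k$ is the path on $k$ vertices, $P_2 \cup P_3$ is the disjoint union of $P_2$ and $P_3$ (a graph on 5 vertices), and $\overline{P_2\cup P_3}$ is its complement. A graph is $F$-free if it contains no subgraph isomorphic to $F$. $G \to (3,3)^e$ means that every coloring of the edges of $G$ with 2 colors contains a monochromatic $K_3$. $N(u)$ is the set of neighbors of $u$ and $G[S]$ is the subgraph induced by $S$; $C_4$ is the 4-cycle.
   Formalization: Item 5 is proved for every vertex with at least one neighbour: minimality under edge deletion does not exclude isolated vertices, and adding one to G keeps all hypotheses while giving a vertex of degree 0. *)

theory Defs
  imports Complex_Main "HOL-Library.Ramsey"
begin

datatype 'a graph = Graph (verts: "'a set") (edges: "'a set set")

definition simple_graph :: "'a graph \<Rightarrow> bool" where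
  "simple_graph G \<longleftrightarrow> finite (verts G) \<and> edges G \<subseteq> nsets (verts G) 2"

definition subgraph :: "'a graph \<Rightarrow> 'a graph \<Rightarrow> bool" where
  "subgraph F G \<longleftrightarrow> verts F \<subseteq> verts G \<and> edges F \<subseteq> edges G"

definition isomorphic :: "'a graph \<Rightarrow> 'b graph \<Rightarrow> bool" where
  "isomorphic F G \<longleftrightarrow>
     (\<exists>f. bij_betw f (verts F) (verts G) \<and> edges G = (\<lambda>e. f ` e) ` edges F)"

text \<open>Copies of \<open>F\<close> in \<open>G\<close> are subgraphs that need not be induced.\<close>

definition copies :: "'b graph \<Rightarrow> 'a graph \<Rightarrow> 'a graph set" where
  "copies F G = {F'. subgraph F' G \<and> isomorphic F F'}"

definition free_of :: "'b graph \<Rightarrow> 'a graph \<Rightarrow> bool" where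
  "free_of F G \<longleftrightarrow> copies F G = {}"

definition path_graph :: "nat \<Rightarrow> nat graph" where
  "path_graph k = Graph {..<k} {{i, Suc i} | i. Suc i < k}"

definition complete_graph :: "nat \<Rightarrow> nat graph" where
  "complete_graph k = Graph {..<k} (nsets {..<k} 2)"

text \<open>This is the \<open>k\<close>-cycle for \<open>k \<ge> 3\<close> only.\<close>

definition cycle_graph :: "nat \<Rightarrow> nat graph" where
  "cycle_graph k = Graph {..<k} {{i, Suc i mod k} | i. i < k}"

definition disjoint_union :: "'a graph \<Rightarrow> 'b graph \<Rightarrow> ('a + 'b) graph" where
  "disjoint_union F G =
     Graph (verts F <+> verts G) ((\<lambda>e. Inl ` e) ` edges F \<union> (\<lambda>e. Inr ` e) ` edges G)"

definition complement :: "'a graph \<Rightarrow> 'a graph" where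
  "complement G = Graph (verts G) (nsets (verts G) 2 - edges G)"

definition co_P2_P3 :: "(nat + nat) graph" where
  "co_P2_P3 = complement (disjoint_union (path_graph 2) (path_graph 3))"

text \<open>The arrowing relation \<open>G \<rightarrow> (3,3)\<^sup>e\<close>; the values of a colouring outside
  \<open>edges G\<close> are irrelevant.\<close>

definition arrows_33 :: "'a graph \<Rightarrow> bool" where
  "arrows_33 G \<longleftrightarrow>
     (\<forall>c :: 'a set \<Rightarrow> bool. \<exists>T \<in> copies (complete_graph 3) G. \<exists>k. \<forall>e \<in> edges T. c e = k)"

definition delete_edge :: "'a graph \<Rightarrow> 'a set \<Rightarrow> 'a graph" where
  "delete_edge G e = Graph (verts G) (edges G - {e})"

definition adjacent :: "'a graph \<Rightarrow> 'a \<Rightarrow> 'a \<Rightarrow> bool" where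
  "adjacent G u v \<longleftrightarrow> {u, v} \<in> edges G"

definition neighbors :: "'a graph \<Rightarrow> 'a \<Rightarrow> 'a set" where
  "neighbors G u = {v \<in> verts G. adjacent G u v}"

definition degree :: "'a graph \<Rightarrow> 'a \<Rightarrow> nat" where
  "degree G u = card (neighbors G u)"

definition induced :: "'a graph \<Rightarrow> 'a set \<Rightarrow> 'a graph" where
  "induced G S = Graph (verts G \<inter> S) {e \<in> edges G. e \<subseteq> S}"

definition link :: "'a graph \<Rightarrow> 'a \<Rightarrow> 'a graph" where
  "link G u = induced G (neighbors G u)"

definition non_neighbors :: "'a graph \<Rightarrow> 'a \<Rightarrow> 'a set" where
  "non_neighbors G u = verts G - (neighbors G u \<union> {u})"

end

theory Submission
  imports Defs
begin

text \<open>Each claim recolours a triangle-avoiding colouring of \<open>G\<close> minus one edge. Freeness from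
  \<open>co_P2_P3\<close> forces every triangle sharing an edge with a \<open>K\<^sub>4\<close> to lie inside that
  \<open>K\<^sub>4\<close>, so a \<open>K\<^sub>4\<close> could be recoloured on its own, and an edge in at most one
  triangle can always be coloured. Hence links have girth at least 5 and minimum degree at least 2.
  Such a graph on at most 7 vertices has a vertex 2-colouring with at most one monochromatic edge;
  this colouring or its negation extends a colouring of \<open>G - u\<close> to the star of \<open>u\<close>.\<close>

section \<open>Embeddings and the small concrete graphs\<close>

text \<open>Copies need not be induced, so the image of \<open>F\<close> under an injective
  edge-preserving map is itself a copy. This trades subgraphs and isomorphisms for a single map
  \<open>f\<close>.\<close>

lemma free_of_iff:
  "free_of F G \<longleftrightarrow>
    \<not> (\<exists>f. inj_on f (verts F) \<and> f ` verts F \<subseteq> verts G \<and> (\<forall>e \<in> edges F. f ` e \<in> edges G))"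
proof
  assume *: "free_of F G"
  show "\<not> (\<exists>f. inj_on f (verts F) \<and> f ` verts F \<subseteq> verts G \<and> (\<forall>e \<in> edges F. f ` e \<in> edges G))"
  proof
    assume "\<exists>f. inj_on f (verts F) \<and> f ` verts F \<subseteq> verts G \<and> (\<forall>e \<in> edges F. f ` e \<in> edges G)"
    then obtain f where "inj_on f (verts F)" "f ` verts F \<subseteq> verts G" "\<forall>e \<in> edges F. f ` e \<in> edges G"
      by blast
    then have "Graph (f ` verts F) ((\<lambda>e. f ` e) ` edges F) \<in> copies F G"
      unfolding copies_def subgraph_def isomorphic_def
      by (auto intro!: exI[of _ f] simp: bij_betw_def)
    with * show False unfolding free_of_def by blast
  qed
next
  assume *: "\<not> (\<exists>f. inj_on f (verts F) \<and> f ` verts F \<subseteq> verts G \<and> (\<forall>e \<in> edges F. f ` e \<in> edges G))"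
  have False if "F' \<in> copies F G" for F'
  proof -
    from that have sub: "verts F' \<subseteq> verts G" "edges F' \<subseteq> edges G" and "isomorphic F F'"
      by (auto simp: copies_def subgraph_def)
    then obtain f where "inj_on f (verts F)" "f ` verts F = verts F'" "edges F' = (\<lambda>e. f ` e) ` edges F"
      unfolding isomorphic_def bij_betw_def by blast
    with * sub show False by blast
  qed
  then show "free_of F G"
    unfolding free_of_def by blast
qed

lemma edges_complete_graph_3: "edges (complete_graph 3) = {{0, 1}, {1, 2}, {0, 2}}"
proof -
  have *: "{..<3::nat} = {0, 1, 2}" by auto
  show ?thesis
    unfolding complete_graph_def nsets_2_eq * graph.sel
    by (simp add: insert_Diff_if, simp add: insert_commute)
qed

lemma edges_cycle_graph_4: "edges (cycle_graph 4) = {{0, 1}, {1, 2}, {2, 3}, {3, 0}}"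
proof -
  have "{{i, Suc i mod 4} | i. i < 4} = (\<lambda>i. {i, Suc i mod 4}) ` {..<4}" by auto
  also have "{..<4::nat} = {0, 1, 2, 3}" by auto
  finally have "edges (cycle_graph 4) = {{0, 1}, {1, Suc 1}, {2, Suc 2}, {3, 0}}"
    by (simp add: cycle_graph_def)
  moreover have "Suc 1 = 2" "Suc 2 = 3" by simp_all
  ultimately show ?thesis by (simp only:)
qed

lemma edges_path_graph_2: "edges (path_graph 2) = {{0, 1}}"
proof -
  have "{{i, Suc i} | i. Suc i < 2} = (\<lambda>i. {i, Suc i}) ` {0}" by auto
  then show ?thesis
    by (simp add: path_graph_def)
qed

lemma edges_path_graph_3: "edges (path_graph 3) = {{0, 1}, {1, 2}}"
proof -
  have "{{i, Suc i} | i. Suc i < 3} = (\<lambda>i. {i, Suc i}) ` {..<2}" by auto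
  also have "{..<2::nat} = {0, 1}" by auto
  finally have "edges (path_graph 3) = {{0, 1}, {1, Suc 1}}"
    by (simp add: path_graph_def)
  moreover have "Suc 1 = 2" by simp
  ultimately show ?thesis by (simp only:)
qed

section \<open>Triangles, arrowing and the forbidden graph in terms of vertices\<close>

lemma adjacent_commute: "adjacent G x y \<longleftrightarrow> adjacent G y x"
  by (simp add: adjacent_def insert_commute)

definition triangle :: "'a graph \<Rightarrow> 'a \<Rightarrow> 'a \<Rightarrow> 'a \<Rightarrow> bool" where
  "triangle G x y z \<longleftrightarrow> adjacent G x y \<and> adjacent G y z \<and> adjacent G x z"

lemma adjacentD:
  assumes "simple_graph G" "adjacent G x y"
  shows "x \<noteq> y" "x \<in> verts G" "y \<in> verts G"
  using assms by (auto simp: simple_graph_def adjacent_def nsets_def card_insert_if split: if_splits)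

lemma edgeE:
  assumes "simple_graph G" "e \<in> edges G"
  obtains x y where "e = {x, y}" "adjacent G x y"
proof -
  have "e \<in> nsets (verts G) 2"
    using assms by (auto simp: simple_graph_def)
  then show thesis
    using assms(2) that by (auto simp: adjacent_def nsets_2_eq)
qed

text \<open>Each triangle is listed once per ordering of its vertices. The explicit form serves both
  the arrowing relation and the count of triangles on an edge.\<close>

lemma copies_K3_eq:
  assumes "simple_graph G"
  shows "copies (complete_graph 3) G =
    {Graph {x, y, z} {{x, y}, {y, z}, {x, z}} | x y z. triangle G x y z}"
proof -
  have v: "verts (complete_graph 3) = {0, 1, 2}"
    by (auto simp: complete_graph_def)
  have copyD: "\<exists>x y z. T = Graph {x, y, z} {{x, y}, {y, z}, {x, z}} \<and> triangle G x y z"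
    if T: "T \<in> copies (complete_graph 3) G" for T
  proof -
    from T have "isomorphic (complete_graph 3) T" and G: "edges T \<subseteq> edges G"
      by (auto simp: copies_def subgraph_def)
    then obtain f where "bij_betw f (verts (complete_graph 3)) (verts T)"
      "edges T = (\<lambda>e. f ` e) ` edges (complete_graph 3)"
      unfolding isomorphic_def by blast
    then have f: "verts T = {f 0, f 1, f 2}" "edges T = {{f 0, f 1}, {f 1, f 2}, {f 0, f 2}}"
      unfolding bij_betw_def edges_complete_graph_3 v by auto
    then have "T = Graph {f 0, f 1, f 2} {{f 0, f 1}, {f 1, f 2}, {f 0, f 2}}"
      by (cases T) auto
    moreover have "triangle G (f 0) (f 1) (f 2)"
      using f(2) G by (auto simp: triangle_def adjacent_def)
    ultimately show ?thesis by blast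
  qed
  have copyI: "Graph {x, y, z} {{x, y}, {y, z}, {x, z}} \<in> copies (complete_graph 3) G"
    if "triangle G x y z" for x y z
  proof -
    let ?f = "\<lambda>i::nat. if i = 0 then x else if i = 1 then y else z"
    have d: "x \<noteq> y" "y \<noteq> z" "x \<noteq> z" "{x, y, z} \<subseteq> verts G"
      using that adjacentD[OF assms] by (auto simp: triangle_def)
    have "bij_betw ?f {0, 1, 2} {x, y, z}"
      using d by (auto simp: bij_betw_def inj_on_def)
    moreover have "{{x, y}, {y, z}, {x, z}} = (\<lambda>e. ?f ` e) ` {{0, 1}, {1, 2}, {0, 2}}"
      by auto
    ultimately have "isomorphic (complete_graph 3) (Graph {x, y, z} {{x, y}, {y, z}, {x, z}})"
      unfolding isomorphic_def edges_complete_graph_3 v graph.sel by (intro exI conjI)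
    then show ?thesis
      using that d by (simp add: copies_def subgraph_def triangle_def adjacent_def)
  qed
  show ?thesis
    by (intro equalityI subsetI CollectI copyD, assumption) (elim CollectE exE conjE, simp only: copyI)
qed

lemma arrows_33_iff:
  fixes G :: "'a graph"
  assumes "simple_graph G"
  shows "arrows_33 G \<longleftrightarrow>
    (\<forall>c :: 'a set \<Rightarrow> bool. \<exists>x y z. triangle G x y z \<and> c {x, y} = c {y, z} \<and> c {y, z} = c {x, z})"
proof -
  have bex: "(\<exists>T \<in> {g x y z | x y z. P x y z}. Q T) \<longleftrightarrow> (\<exists>x y z. P x y z \<and> Q (g x y z))"
    for g :: "'a \<Rightarrow> 'a \<Rightarrow> 'a \<Rightarrow> 'a graph" and P Q
    by blast
  have "(\<exists>T \<in> copies (complete_graph 3) G. \<exists>k. \<forall>e \<in> edges T. c e = k) \<longleftrightarrow>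
    (\<exists>x y z. triangle G x y z \<and> c {x, y} = c {y, z} \<and> c {y, z} = c {x, z})" for c :: "'a set \<Rightarrow> bool"
    unfolding copies_K3_eq[OF assms] bex graph.sel
    by (intro arg_cong[where f = Ex] ext conj_cong refl) auto
  then show ?thesis
    unfolding arrows_33_def by simp
qed

text \<open>The vertices \<open>a\<close>, \<open>b\<close> play the part of \<open>P_2\<close> and
  \<open>c\<close>, \<open>d\<close>, \<open>e\<close> that of \<open>P_3\<close> with middle vertex
  \<open>d\<close>. The seven adjacencies are the edges of the complement; the three inequalities
  sit at its three non-edges, the only pairs whose distinctness does not follow from
  adjacency.\<close>

lemma co_P2_P3_free_imp:
  assumes "simple_graph G" "free_of co_P2_P3 G"
    and "a \<noteq> b" "c \<noteq> d" "d \<noteq> e"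
    and "adjacent G a c" "adjacent G a d" "adjacent G a e"
    and "adjacent G b c" "adjacent G b d" "adjacent G b e" "adjacent G c e"
  shows False
proof -
  let ?f = "case_sum (\<lambda>i::nat. if i = 0 then a else b)
    (\<lambda>i::nat. if i = 0 then c else if i = 1 then d else e)"
  have two: "{..<2::nat} = {0, 1}" and three: "{..<3::nat} = {0, 1, 2}" by auto
  have v: "verts co_P2_P3 = {Inl 0, Inl 1, Inr 0, Inr 1, Inr 2}"
    by (auto simp: co_P2_P3_def complement_def disjoint_union_def path_graph_def two three)
  have no_edge: "{Inl 0, Inl 1} \<notin> edges co_P2_P3" "{Inr 0, Inr 1} \<notin> edges co_P2_P3"
      "{Inr 1, Inr 2} \<notin> edges co_P2_P3"
    by (simp_all add: co_P2_P3_def complement_def disjoint_union_def edges_path_graph_2 edges_path_graph_3)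
  have E: "edges co_P2_P3 \<subseteq> nsets (verts co_P2_P3) 2"
    by (simp add: co_P2_P3_def complement_def)
  note d = assms(6-)[THEN adjacentD(1)[OF assms(1)]]
  have "inj_on ?f (verts co_P2_P3)"
    unfolding v using assms(3-5) d by (auto simp: inj_on_def)
  moreover have "?f ` verts co_P2_P3 \<subseteq> verts G"
    unfolding v using assms(6-)[THEN adjacentD(2)[OF assms(1)]] assms(6-)[THEN adjacentD(3)[OF assms(1)]]
    by auto
  moreover have "?f ` g \<in> edges G" if g: "g \<in> edges co_P2_P3" for g
  proof -
    obtain x y where xy: "x \<in> verts co_P2_P3" "y \<in> verts co_P2_P3" "x \<noteq> y" "g = {x, y}"
      using subsetD[OF E g] by (auto simp: nsets_2_eq)
    have "adjacent G (?f x) (?f y)"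
      using xy(1-3) g[unfolded xy(4)] no_edge assms(6-) unfolding v
      by (elim insertE emptyE; simp add: adjacent_commute insert_commute)
    then show ?thesis
      by (simp add: xy(4) adjacent_def)
  qed
  ultimately show False
    using assms(2) unfolding free_of_iff by blast
qed

section \<open>Graphs of girth at least 5 on at most seven vertices\<close>

text \<open>Colour by the parity of the distance from a vertex \<open>v\<close> of maximal degree, which is 2 or 3.
  In degree 3 the ball of radius 2 exhausts all seven vertices, and if the second neighbourhood
  contains a path, its middle vertex has to be flipped.\<close>

lemma small_girth_5_almost_bipartite:
  fixes A :: "'a \<Rightarrow> 'a \<Rightarrow> bool"
  assumes fin: "finite N" and card: "card N \<le> 7"
    and sym: "\<And>x y. A x y \<Longrightarrow> A y x" and irr: "\<And>x. \<not> A x x"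
    and C3: "\<And>x y z. \<lbrakk>x \<in> N; y \<in> N; z \<in> N; A x y; A y z; A x z\<rbrakk> \<Longrightarrow> False"
    and C4: "\<And>w x y z. \<lbrakk>w \<in> N; x \<in> N; y \<in> N; z \<in> N; w \<noteq> y; x \<noteq> z; A w x; A x y; A y z; A z w\<rbrakk> \<Longrightarrow> False"
    and deg: "\<And>x. x \<in> N \<Longrightarrow> \<exists>y \<in> N. \<exists>z \<in> N. y \<noteq> z \<and> A x y \<and> A x z"
  shows "\<exists>f :: 'a \<Rightarrow> bool. \<exists>e. \<forall>x \<in> N. \<forall>y \<in> N. A x y \<longrightarrow> f x = f y \<longrightarrow> {x, y} = e"
proof (cases "\<exists>v \<in> N. \<exists>a \<in> N. \<exists>b \<in> N. \<exists>c \<in> N. distinct [a, b, c] \<and> A v a \<and> A v b \<and> A v c")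
  case True
  then obtain v a b c where v: "v \<in> N" "a \<in> N" "b \<in> N" "c \<in> N" "a \<noteq> b" "a \<noteq> c" "b \<noteq> c"
    "A v a" "A v b" "A v c" by auto
  have ex: "\<exists>x' \<in> N. x' \<noteq> v \<and> A x x'" if "x \<in> N" for x
    using deg[OF that] by metis
  obtain a' b' c' where w: "a' \<in> N" "b' \<in> N" "c' \<in> N" "a' \<noteq> v" "b' \<noteq> v" "c' \<noteq> v"
    "A a a'" "A b b'" "A c c'"
    using ex v by metis
  have nv: "\<not> A a b" "\<not> A a c" "\<not> A b c"
    using C3 v sym by blast+
  \<comment> \<open>A coincidence such as \<open>a' = b'\<close> would close the 4-cycle
    \<open>v a a' b\<close>; one such as \<open>a' = b\<close> would put an edge among the
    neighbours of \<open>v\<close>.\<close>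
  have d: "distinct [v, a, b, c, a', b', c']"
    using v w nv irr sym C4[of v a a' b] C4[of v b b' c] C4[of v a a' c] by auto
  then have "card {v, a, b, c, a', b', c'} = 7" by simp
  moreover have "{v, a, b, c, a', b', c'} \<subseteq> N" using v w by simp
  ultimately have N: "N = {v, a, b, c, a', b', c'}"
    using fin card by (metis card_seteq)
  have nA: "\<not> A a b'" "\<not> A a c'" "\<not> A b a'" "\<not> A b c'" "\<not> A c a'" "\<not> A c b'"
    using v w sym C4[of v a b' b] C4[of v a c' c] C4[of v b a' a] C4[of v b c' c] C4[of v c a' a] C4[of v c b' b]
    by metis+
  have nA': "\<not> A v a'" "\<not> A v b'" "\<not> A v c'"
    using v w sym C3 by metis+
  have tri: "\<not> (A a' b' \<and> A b' c' \<and> A a' c')"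
    using C3 w by blast
  note facts = nv nA nA' irr
  note facts = facts facts[THEN contrapos_nn, OF sym]
  \<comment> \<open>The primed vertices span no triangle, so two of them are non-adjacent and can
    share the colour of \<open>v\<close>. The third is moved to the class of \<open>a\<close>,
    \<open>b\<close>, \<open>c\<close>, where its only possible neighbour is its own partner; that
    edge is the exceptional one.\<close>
  from tri consider "\<not> A a' b'" | "\<not> A b' c'" | "\<not> A a' c'" by blast
  then show ?thesis
  proof cases
    case 1
    show ?thesis
      by (rule exI[of _ "\<lambda>x. x \<in> {v, a', b'}"], rule exI[of _ "{c, c'}"])
         (use d facts 1 1[THEN contrapos_nn, OF sym] in \<open>auto simp: N\<close>)
  next
    case 2
    show ?thesis
      by (rule exI[of _ "\<lambda>x. x \<in> {v, b', c'}"], rule exI[of _ "{a, a'}"])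
         (use d facts 2 2[THEN contrapos_nn, OF sym] in \<open>auto simp: N\<close>)
  next
    case 3
    show ?thesis
      by (rule exI[of _ "\<lambda>x. x \<in> {v, a', c'}"], rule exI[of _ "{b, b'}"])
         (use d facts 3 3[THEN contrapos_nn, OF sym] in \<open>auto simp: N\<close>)
  qed
next
  case False
  then have le2: "c = a \<or> c = b" if "v \<in> N" "a \<in> N" "b \<in> N" "c \<in> N" "a \<noteq> b" "A v a" "A v b" "A v c" for v a b c
    using that by auto
  show ?thesis
  proof (cases "N = {}")
    case True
    then show ?thesis by simp
  next
    case False
    then obtain v a b where v: "v \<in> N" "a \<in> N" "b \<in> N" "a \<noteq> b" "A v a" "A v b"
      using deg by blast
    have ex: "\<exists>x' \<in> N. x' \<noteq> v \<and> A x x'" if "x \<in> N" for x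
      using deg[OF that] by metis
    obtain a' b' where w: "a' \<in> N" "b' \<in> N" "a' \<noteq> v" "b' \<noteq> v" "A a a'" "A b b'"
      using ex v by metis
    have nv: "\<not> A a b"
      using C3 v sym by blast
    have d: "distinct [v, a, b, a', b']"
      using v w nv irr sym C4[of v a a' b] by auto
    \<comment> \<open>All degrees are now 2. The path \<open>a' a v b b'\<close> takes five
      vertices, so at most two are left over.\<close>
    define R where "R = N - {v, a, b, a', b'}"
    have "{v, a, b, a', b'} \<subseteq> N" using v w by simp
    then have "card R = card N - 5"
      using d by (simp add: R_def card_Diff_subset)
    then have "card R \<le> 2" using card by simp
    have finR: "finite R" using fin by (simp add: R_def)
    have N: "N = {v, a, b, a', b'} \<union> R"
      using v w by (auto simp: R_def)
    have nb: "A v x \<Longrightarrow> x = a \<or> x = b" "A a x \<Longrightarrow> x = v \<or> x = a'" "A b x \<Longrightarrow> x = v \<or> x = b'" if "x \<in> N" for x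
      using that le2 v w sym by metis+
    \<comment> \<open>If \<open>a'\<close> and \<open>b'\<close> are adjacent, the path closes to a
      5-cycle that already uses both neighbours of each of its vertices. A vertex of
      \<open>R\<close> would then need two neighbours inside \<open>R\<close>, which is too small
      for that.\<close>
    have no_edge_R: "\<not> A p q" if inR: "p \<in> R" "q \<in> R" "A a' b'" for p q
    proof
      assume "A p q"
      then have "p \<noteq> q" using irr by auto
      then have "R = {p, q}"
        using inR \<open>card R \<le> 2\<close> finR by (metis card_2_iff card_seteq empty_subsetI insert_subset)
      obtain r where r: "r \<in> N" "r \<noteq> q" "A p r"
        using deg[of p] inR(1) unfolding R_def by blast
      then have "r \<in> {v, a, b, a', b'}"
        using irr N \<open>R = {p, q}\<close> by auto
      moreover have "p \<in> N" "p \<notin> {v, a, b, a', b'}" using inR(1) by (auto simp: R_def)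
      moreover have "A a' x \<Longrightarrow> x = a \<or> x = b'" "A b' x \<Longrightarrow> x = b \<or> x = a'" if "x \<in> N" for x
        using that le2[of a' a b' x] le2[of b' b a' x] \<open>A a' b'\<close> v w sym d by auto
      ultimately show False
        using nb[of p] sym[OF r(3)] by auto
    qed
    show ?thesis
    proof (cases "A a' b'")
      case True
      have "\<forall>x \<in> N. \<forall>y \<in> N. A x y \<longrightarrow> (x \<in> {v, a', b'}) = (y \<in> {v, a', b'}) \<longrightarrow> {x, y} = {a', b'}"
      proof (intro ballI impI)
        fix x y assume xy: "x \<in> N" "y \<in> N" "A x y" "(x \<in> {v, a', b'}) = (y \<in> {v, a', b'})"
        then show "{x, y} = {a', b'}"
          using d nb[OF xy(1)] nb[OF xy(2)] sym[OF xy(3)] irr no_edge_R[OF _ _ True] N by auto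
      qed
      then show ?thesis by (intro exI)
    next
      case False
      \<comment> \<open>The path stays properly coloured, so a monochromatic edge lies within
        \<open>R\<close> and must be all of it. If \<open>R\<close> has fewer than two vertices,
        \<open>{p, q}\<close> is a mere placeholder.\<close>
      obtain p q where pq: "R \<subseteq> {p, q}"
      proof -
        consider "card R = 0" | "card R = 1" | "card R = 2" using \<open>card R \<le> 2\<close> by linarith
        then show thesis
          using that finR by cases (auto simp: card_1_singleton_iff card_2_iff)
      qed
      have "\<forall>x \<in> N. \<forall>y \<in> N. A x y \<longrightarrow> (x \<in> {v, a', b'}) = (y \<in> {v, a', b'}) \<longrightarrow> {x, y} = {p, q}"
      proof (intro ballI impI)
        fix x y assume xy: "x \<in> N" "y \<in> N" "A x y" "(x \<in> {v, a', b'}) = (y \<in> {v, a', b'})"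
        have "x \<noteq> y" using xy irr by auto
        moreover have "x \<in> R \<and> y \<in> R"
          using xy d nb[OF xy(1)] nb[OF xy(2)] sym[OF xy(3)] irr False sym[of b' a'] N by auto
        ultimately show "{x, y} = {p, q}"
          using pq by auto
      qed
      then show ?thesis by (intro exI)
    qed
  qed
qed

section \<open>Minimal arrowing graphs and colourings off one edge\<close>

locale minimal_arrowing =
  fixes G :: "'a graph"
  assumes simple: "simple_graph G"
    and H_free: "free_of co_P2_P3 G"
    and arrows: "arrows_33 G"
    and minimal: "\<forall>e \<in> edges G. \<not> arrows_33 (delete_edge G e)"
begin

lemmas adjD = adjacentD[OF simple]
lemmas no_H = co_P2_P3_free_imp[OF simple H_free]

lemma monochromatic_triangle:
  "\<exists>x y z. triangle G x y z \<and> c {x, y} = c {y, z} \<and> c {y, z} = c {x, z}" for c :: "'a set \<Rightarrow> bool"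
  using arrows arrows_33_iff[OF simple] by blast

text \<open>The form in which minimality is applied: deleting \<open>e\<close> destroys exactly the
  triangles through \<open>e\<close>, so a good colouring of the rest can fail in \<open>G\<close>
  only on those.\<close>

lemma coloring_off_edge:
  assumes "e \<in> edges G"
  obtains c :: "'a set \<Rightarrow> bool" where
    "\<And>x y z. \<lbrakk>triangle G x y z; {x, y} \<noteq> e; {y, z} \<noteq> e; {x, z} \<noteq> e;
      c {x, y} = c {y, z}; c {y, z} = c {x, z}\<rbrakk> \<Longrightarrow> False"
proof -
  have "simple_graph (delete_edge G e)"
    using simple by (auto simp: simple_graph_def delete_edge_def)
  then have "\<not> (\<forall>c :: 'a set \<Rightarrow> bool. \<exists>x y z. triangle (delete_edge G e) x y z \<and> c {x, y} = c {y, z} \<and> c {y, z} = c {x, z})"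
    using arrows_33_iff minimal assms by blast
  then obtain c :: "'a set \<Rightarrow> bool" where "\<And>x y z. \<lbrakk>triangle (delete_edge G e) x y z;
      c {x, y} = c {y, z}; c {y, z} = c {x, z}\<rbrakk> \<Longrightarrow> False"
    by blast
  then show thesis
    unfolding triangle_def adjacent_def delete_edge_def graph.sel
    by (intro that[of c, unfolded triangle_def adjacent_def]) blast
qed

section \<open>Absence of \<open>K_4\<close>\<close>

lemma clique_card_neq_4:
  assumes clique: "\<And>x y. x \<in> K \<Longrightarrow> y \<in> K \<Longrightarrow> x \<noteq> y \<Longrightarrow> adjacent G x y"
  shows "card K \<noteq> 4"
proof
  assume K4: "card K = 4"
  then obtain p q r s where K: "K = {p, q, r, s}" and d: "distinct [p, q, r, s]"
    by (auto simp: card_Suc_eq numeral_eq_Suc)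
  \<comment> \<open>If the apex \<open>z\<close> were outside \<open>K\<close>, then
    \<open>x\<close> and \<open>y\<close> would both be joined to \<open>z\<close> and to the other
    two vertices \<open>a\<close>, \<open>b\<close> of \<open>K\<close>. With the edge
    \<open>ab\<close> this is the forbidden graph, \<open>z\<close> being the middle of
    \<open>P_3\<close>.\<close>
  have closed: "z \<in> K" if "x \<in> K" "y \<in> K" "triangle G x y z" for x y z
  proof (rule ccontr)
    assume z: "z \<notin> K"
    have xy: "x \<noteq> y" "adjacent G x z" "adjacent G y z"
      using that adjD by (auto simp: triangle_def)
    have "card (K - {x, y}) = 2"
      using that xy K4 by (simp add: card_Diff_subset)
    then obtain a b where ab: "K - {x, y} = {a, b}" "a \<noteq> b"
      by (auto simp: card_2_iff)
    then have "a \<in> K" "b \<in> K" "a \<noteq> x" "a \<noteq> y" "b \<noteq> x" "b \<noteq> y" by blast+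
    then show False
      using no_H[of x y a z b] xy ab(2) that(1,2) z clique by metis
  qed
  have "{p, q} \<in> edges G"
    using clique[of p q] d K by (simp add: adjacent_def)
  then obtain c :: "'a set \<Rightarrow> bool" where c: "\<And>x y z. \<lbrakk>triangle G x y z; {x, y} \<noteq> {p, q}; {y, z} \<noteq> {p, q};
      {x, z} \<noteq> {p, q}; c {x, y} = c {y, z}; c {y, z} = c {x, z}\<rbrakk> \<Longrightarrow> False"
    using coloring_off_edge by blast
  \<comment> \<open>Inside \<open>K\<close> the 4-cycle between \<open>{p, q}\<close> and
    \<open>{r, s}\<close> gets one colour and the two edges \<open>pq\<close>, \<open>rs\<close> the
    other, so no triangle of \<open>K\<close> is monochromatic. By \<open>closed\<close>, every
    other triangle has all its edges outside \<open>K\<close> and keeps its colours from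
    \<open>c\<close>.\<close>
  define c' where "c' f = (if f \<subseteq> K then f \<inter> {p, q} \<noteq> {} \<and> f \<inter> {r, s} \<noteq> {} else c f)" for f
  obtain x y z where t: "triangle G x y z" "c' {x, y} = c' {y, z}" "c' {y, z} = c' {x, z}"
    using monochromatic_triangle by blast
  have sym: "triangle G y z x" "triangle G x z y"
    using t(1) by (auto simp: triangle_def adjacent_commute)
  have ne: "x \<noteq> y" "y \<noteq> z" "x \<noteq> z"
    using t(1) adjD(1) by (auto simp: triangle_def)
  show False
  proof (cases "x \<in> K \<and> y \<in> K \<or> y \<in> K \<and> z \<in> K \<or> x \<in> K \<and> z \<in> K")
    case True
    then have "x \<in> K" "y \<in> K" "z \<in> K"
      using closed t(1) sym by blast+
    then show False
      using t(2,3) ne d unfolding c'_def K by auto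
  next
    case False
    then show False
      using c[OF t(1)] t(2,3) unfolding c'_def K by (auto simp: doubleton_eq_iff)
  qed
qed

lemma K4_free: "free_of (complete_graph 4) G"
  unfolding free_of_iff
proof (rule notI, elim exE conjE)
  fix f assume f: "inj_on f (verts (complete_graph 4))"
    "\<forall>e \<in> edges (complete_graph 4). f ` e \<in> edges G"
  have "adjacent G x y" if xy: "x \<in> f ` {..<4}" "y \<in> f ` {..<4}" "x \<noteq> y" for x y
  proof -
    obtain i j where "x = f i" "y = f j" "i < 4" "j < 4" "i \<noteq> j"
      using xy by auto
    moreover from this have "{i, j} \<in> edges (complete_graph 4)"
      by (auto simp: complete_graph_def nsets_def)
    ultimately show ?thesis
      using f(2) by (force simp: adjacent_def)
  qed
  moreover have "card (f ` {..<4}) = 4"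
    using f(1) by (simp add: complete_graph_def card_image)
  ultimately show False
    using clique_card_neq_4 by blast
qed

lemma no_K4:
  assumes "triangle G x y z" "adjacent G u x" "adjacent G u y" "adjacent G u z"
  shows False
proof -
  have "distinct [u, x, y, z]"
    using assms adjD(1) by (auto simp: triangle_def)
  then have "card {u, x, y, z} = 4" by simp
  moreover have "adjacent G a b" if "a \<in> {u, x, y, z}" "b \<in> {u, x, y, z}" "a \<noteq> b" for a b
    using that assms by (auto simp: triangle_def adjacent_commute)
  ultimately show False using clique_card_neq_4 by blast
qed

section \<open>Triangles on an edge\<close>

lemma two_triangles_on_edge:
  assumes "adjacent G x y"
  obtains v w where "v \<noteq> w" "triangle G x y v" "triangle G x y w"
proof -
  have "\<exists>v w. v \<noteq> w \<and> triangle G x y v \<and> triangle G x y w"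
  proof (rule ccontr)
    assume "\<not> ?thesis"
    \<comment> \<open>The apex of the only possible triangle on the edge; arbitrary if there is
      none. Giving \<open>{x, y}\<close> the colour opposite to \<open>{x, t}\<close> then spoils
      that triangle and leaves all others as they were.\<close>
    then obtain t where t: "\<And>v. triangle G x y v \<Longrightarrow> v = t" by metis
    have "{x, y} \<in> edges G" using assms by (simp add: adjacent_def)
    then obtain c :: "'a set \<Rightarrow> bool" where c: "\<And>a b d. \<lbrakk>triangle G a b d; {a, b} \<noteq> {x, y}; {b, d} \<noteq> {x, y};
      {a, d} \<noteq> {x, y}; c {a, b} = c {b, d}; c {b, d} = c {a, d}\<rbrakk> \<Longrightarrow> False"
      using coloring_off_edge by blast
    obtain a b d where m: "triangle G a b d"
      "(c({x, y} := \<not> c {x, t})) {a, b} = (c({x, y} := \<not> c {x, t})) {b, d}"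
      "(c({x, y} := \<not> c {x, t})) {b, d} = (c({x, y} := \<not> c {x, t})) {a, d}"
      using monochromatic_triangle by blast
    have ne: "a \<noteq> b" "b \<noteq> d" "a \<noteq> d"
      using m(1) adjD(1) by (auto simp: triangle_def)
    consider "{a, b} = {x, y}" | "{b, d} = {x, y}" | "{a, d} = {x, y}"
      using c[OF m(1)] m(2,3) by (auto simp del: doubleton_eq_iff split: if_splits)
    then show False
    proof cases
      case 1
      then have "triangle G x y d"
        using m(1) by (auto simp: triangle_def doubleton_eq_iff adjacent_commute)
      then have "d = t" by (rule t)
      then show False using 1 m(2,3) ne by (auto simp: doubleton_eq_iff insert_commute)
    next
      case 2
      then have "triangle G x y a"
        using m(1) by (auto simp: triangle_def doubleton_eq_iff adjacent_commute)
      then have "a = t" by (rule t)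
      then show False using 2 m(2,3) ne by (auto simp: doubleton_eq_iff insert_commute)
    next
      case 3
      then have "triangle G x y b"
        using m(1) by (auto simp: triangle_def doubleton_eq_iff adjacent_commute)
      then have "b = t" by (rule t)
      then show False using 3 m(2,3) ne by (auto simp: doubleton_eq_iff insert_commute)
    qed
  qed
  then show thesis using that by blast
qed

lemma card_triangles_on_edge:
  assumes "e \<in> edges G"
  shows "2 \<le> card {T \<in> copies (complete_graph 3) G. e \<in> edges T}"
proof -
  obtain x y where e: "e = {x, y}" "adjacent G x y"
    using edgeE[OF simple assms] by blast
  obtain v w where vw: "v \<noteq> w" "triangle G x y v" "triangle G x y w"
    using two_triangles_on_edge[OF e(2)] by blast
  let ?T = "\<lambda>z. Graph {x, y, z} {{x, y}, {y, z}, {x, z}}"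
  \<comment> \<open>Finiteness of the set of copies matters because \<open>card\<close> is 0 on
    infinite sets, which would defeat the lower bound.\<close>
  have "finite (verts G)" "finite (edges G)"
    using simple finite_subset[OF _ finite_imp_finite_nsets] by (auto simp: simple_graph_def)
  then have "finite ((\<lambda>(V, E). Graph V E) ` (Pow (verts G) \<times> Pow (edges G)))"
    by simp
  moreover have "copies (complete_graph 3) G \<subseteq> (\<lambda>(V, E). Graph V E) ` (Pow (verts G) \<times> Pow (edges G))"
  proof
    fix T assume "T \<in> copies (complete_graph 3) G"
    then show "T \<in> (\<lambda>(V, E). Graph V E) ` (Pow (verts G) \<times> Pow (edges G))"
      by (cases T) (auto simp: copies_def subgraph_def)
  qed
  ultimately have fin: "finite {T \<in> copies (complete_graph 3) G. e \<in> edges T}"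
    by (auto intro: finite_subset)
  have sub: "{?T v, ?T w} \<subseteq> {T \<in> copies (complete_graph 3) G. e \<in> edges T}"
    using vw e by (auto simp: copies_K3_eq[OF simple])
  have "v \<noteq> x" "v \<noteq> y"
    using vw(2) adjD(1) by (auto simp: triangle_def)
  then have "v \<in> {x, y, v}" "v \<notin> {x, y, w}"
    using vw(1) by auto
  then have "?T v \<noteq> ?T w" by (metis graph.sel(1))
  then have "card {?T v, ?T w} = 2" by simp
  then show ?thesis
    using card_mono[OF fin sub] by (simp only:)
qed

section \<open>Structure of the links\<close>

lemma neighbors_iff: "v \<in> neighbors G u \<longleftrightarrow> adjacent G u v"
  using adjD by (auto simp: neighbors_def)

lemma verts_link: "verts (link G u) = neighbors G u"
  by (auto simp: link_def induced_def neighbors_def)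

text \<open>Translates statements about links into statements about triangles through
  \<open>u\<close>, to which the colouring arguments apply.\<close>

lemma adjacent_link_iff:
  "adjacent (link G u) x y \<longleftrightarrow> triangle G u x y"
  by (auto simp: link_def induced_def adjacent_def[of "Graph _ _"] neighbors_iff triangle_def)
     (auto simp: adjacent_def)

lemma edge_linkE:
  assumes "e \<in> edges (link G u)"
  obtains x y where "e = {x, y}" "triangle G u x y"
proof -
  have "simple_graph (link G u)"
    using simple by (auto simp: simple_graph_def link_def induced_def nsets_def)
  then show thesis
    using edgeE[OF _ assms] that by (auto simp: adjacent_link_iff)
qed

text \<open>The neighbours of \<open>v\<close> in the link are the apexes of the triangles on the
  edge \<open>uv\<close>.\<close>

lemma degree_link:
  assumes "v \<in> verts (link G u)"
  shows "2 \<le> degree (link G u) v"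
proof -
  have "adjacent G u v" using assms by (simp add: verts_link neighbors_iff)
  then obtain x y where xy: "x \<noteq> y" "triangle G u v x" "triangle G u v y"
    using two_triangles_on_edge by blast
  have "{x, y} \<subseteq> neighbors (link G u) v"
    using xy by (auto simp: neighbors_def[of "link G u"] verts_link adjacent_link_iff neighbors_iff triangle_def)
  moreover have "finite (neighbors (link G u) v)"
    using simple by (auto simp: neighbors_def link_def induced_def simple_graph_def)
  ultimately show ?thesis
    using xy(1) card_mono[of "neighbors (link G u) v" "{x, y}"] by (simp add: degree_def)
qed

lemma K3_free_link: "free_of (complete_graph 3) (link G u)"
  unfolding free_of_iff edges_complete_graph_3
proof (rule notI, elim exE conjE)
  fix f assume "\<forall>e \<in> {{0, 1}, {1, 2}, {0, 2::nat}}. f ` e \<in> edges (link G u)"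
  then have "adjacent (link G u) (f 0) (f 1)" "adjacent (link G u) (f 1) (f 2)" "adjacent (link G u) (f 0) (f 2)"
    by (auto simp: adjacent_def)
  then show False
    using no_K4[of "f 0" "f 1" "f 2" u] by (auto simp: adjacent_link_iff triangle_def)
qed

text \<open>A 4-cycle in the link forms a wheel with hub \<open>u\<close>, and the forbidden graph
  is that wheel minus one spoke.\<close>

lemma no_C4_link:
  assumes "triangle G u w x" "triangle G u x y" "triangle G u y z" "triangle G u z w" "w \<noteq> y" "x \<noteq> z"
  shows False
  using no_H[of x z u y w] no_H[of w y u z x] assms adjD(1)
  by (auto simp: triangle_def adjacent_commute)

lemma C4_free_link: "free_of (cycle_graph 4) (link G u)"
  unfolding free_of_iff edges_cycle_graph_4
proof (rule notI, elim exE conjE)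
  fix f assume f: "inj_on f (verts (cycle_graph 4))"
    "\<forall>e \<in> {{0, 1}, {1, 2}, {2, 3}, {3, 0::nat}}. f ` e \<in> edges (link G u)"
  have "f 0 \<noteq> f 2" "f 1 \<noteq> f 3"
    using f(1) by (simp_all add: cycle_graph_def inj_on_eq_iff)
  moreover have "adjacent (link G u) (f 0) (f 1)" "adjacent (link G u) (f 1) (f 2)"
    "adjacent (link G u) (f 2) (f 3)" "adjacent (link G u) (f 3) (f 0)"
    using f(2) by (auto simp: adjacent_def)
  ultimately show False
    using no_C4_link[of u "f 0" "f 1" "f 2" "f 3"] by (simp add: adjacent_link_iff)
qed

lemma edge_link_common_neighbor:
  assumes "e \<in> edges (link G u)"
  shows "\<exists>v \<in> non_neighbors G u. \<forall>x \<in> e. adjacent G v x"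
proof -
  obtain x y where e: "e = {x, y}" "triangle G u x y"
    using edge_linkE[OF assms] by blast
  \<comment> \<open>The second triangle on the edge provides the vertex; were its apex adjacent to
    \<open>u\<close>, a \<open>K_4\<close> would arise.\<close>
  then obtain v where v: "v \<noteq> u" "triangle G x y v"
    using two_triangles_on_edge[of x y] by (metis triangle_def)
  then have "\<not> adjacent G u v"
    using no_K4[of x y v u] e by (auto simp: triangle_def)
  then have "v \<in> non_neighbors G u"
    using v adjD by (auto simp: non_neighbors_def neighbors_iff triangle_def)
  then show ?thesis
    using v e by (auto simp: triangle_def adjacent_commute)
qed

text \<open>If one \<open>v\<close> served both edges, \<open>u\<close> and \<open>v\<close> would
  both be joined to the ends \<open>x\<close>, \<open>y\<close> of \<open>e\<close> and to an end
  \<open>z\<close> of \<open>f\<close> off \<open>e\<close>. With the edge \<open>xy\<close> this is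
  the forbidden graph.\<close>

lemma edge_link_common_neighbor_distinct:
  assumes "e \<in> edges (link G u)" "f \<in> edges (link G u)" "e \<noteq> f"
    and "v \<in> non_neighbors G u" "\<forall>x \<in> e. adjacent G v x" "\<forall>x \<in> f. adjacent G v x"
  shows False
proof -
  obtain x y where e: "e = {x, y}" "triangle G u x y"
    using edge_linkE[OF assms(1)] by blast
  obtain a b where f: "f = {a, b}" "triangle G u a b"
    using edge_linkE[OF assms(2)] by blast
  have "a \<noteq> b" using f adjD by (auto simp: triangle_def)
  then obtain z where z: "z \<in> f" "z \<noteq> x" "z \<noteq> y"
    using e f assms(3) by auto
  then have "adjacent G u z" "adjacent G v z"
    using f assms(6) by (auto simp: triangle_def)
  moreover have "u \<noteq> v" using assms(4) by (auto simp: non_neighbors_def)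
  ultimately show False
    using no_H[of u v x z y] z e assms(5) by (auto simp: triangle_def)
qed

section \<open>The degree bound\<close>

text \<open>Minimality constrains edges only, so \<open>G\<close> may have isolated vertices; they
  have degree 0 and must be excluded here.\<close>

lemma degree_ge_8:
  assumes "neighbors G u \<noteq> {}"
  shows "8 \<le> degree G u"
proof (rule ccontr)
  assume "\<not> 8 \<le> degree G u"
  then have le7: "card (neighbors G u) \<le> 7" by (simp add: degree_def)
  have fin: "finite (neighbors G u)"
    using simple by (simp add: neighbors_def simple_graph_def)
  have "\<exists>f :: 'a \<Rightarrow> bool. \<exists>e. \<forall>x \<in> neighbors G u. \<forall>y \<in> neighbors G u.
    adjacent G x y \<longrightarrow> f x = f y \<longrightarrow> {x, y} = e"
  proof (rule small_girth_5_almost_bipartite[OF fin le7])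
    show "adjacent G y x" if "adjacent G x y" for x y
      using that by (simp add: adjacent_commute)
    show "\<not> adjacent G x x" for x
      using adjD(1) by blast
    show False if "x \<in> neighbors G u" "y \<in> neighbors G u" "z \<in> neighbors G u"
      "adjacent G x y" "adjacent G y z" "adjacent G x z" for x y z
      using that no_K4[of x y z u] by (simp add: neighbors_iff triangle_def)
    show False if "w \<in> neighbors G u" "x \<in> neighbors G u" "y \<in> neighbors G u" "z \<in> neighbors G u"
      "w \<noteq> y" "x \<noteq> z" "adjacent G w x" "adjacent G x y" "adjacent G y z" "adjacent G z w" for w x y z
      using that no_C4_link[of u w x y z] by (simp add: neighbors_iff triangle_def)
    show "\<exists>y \<in> neighbors G u. \<exists>z \<in> neighbors G u. y \<noteq> z \<and> adjacent G x y \<and> adjacent G x z"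
      if "x \<in> neighbors G u" for x
      using two_triangles_on_edge[of u x] that by (metis neighbors_iff triangle_def)
  qed
  then obtain f :: "'a \<Rightarrow> bool" and e where "\<forall>x \<in> neighbors G u. \<forall>y \<in> neighbors G u.
    adjacent G x y \<longrightarrow> f x = f y \<longrightarrow> {x, y} = e"
    by blast
  then have f: "{x, y} = e" if "triangle G u x y" "f x = f y" for x y
    using that by (simp add: neighbors_iff triangle_def)
  obtain v where v: "{u, v} \<in> edges G"
    using assms by (auto simp: neighbors_def adjacent_def)
  obtain c :: "'a set \<Rightarrow> bool" where c: "\<And>x y z. \<lbrakk>triangle G x y z; {x, y} \<noteq> {u, v}; {y, z} \<noteq> {u, v};
      {x, z} \<noteq> {u, v}; c {x, y} = c {y, z}; c {y, z} = c {x, z}\<rbrakk> \<Longrightarrow> False"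
    using coloring_off_edge[OF v] by blast
  \<comment> \<open>Only the link edge \<open>e\<close> can be monochromatic under \<open>f\<close>.
    If its common value equals \<open>c e\<close>, the negation of \<open>f\<close> has the same
    monochromatic edges but disagrees with \<open>c\<close> on \<open>e\<close>.\<close>
  obtain g :: "'a \<Rightarrow> bool" where g: "\<And>x y. \<lbrakk>triangle G u x y; g x = g y; g y = c {x, y}\<rbrakk> \<Longrightarrow> False"
  proof (cases "\<exists>x y. triangle G u x y \<and> f x = f y \<and> f y = c {x, y}")
    case True
    then obtain p q where "f p = f q" "f q = c e" "e = {p, q}"
      using f by blast
    then have "(\<not> f y) \<noteq> c {x, y}" if "triangle G u x y" "f x = f y" for x y
      using f[OF that] that(2) by (auto simp: doubleton_eq_iff insert_commute)
    then show thesis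
      using that[of "\<lambda>x. \<not> f x"] by blast
  next
    case False
    then show thesis using that[of f] by blast
  qed
  \<comment> \<open>The spoke from \<open>u\<close> to \<open>x\<close> takes the colour
    \<open>g x\<close>; the existential quantifier reads off the other end of an unordered edge. A
    triangle through \<open>u\<close> is then excluded by \<open>g\<close>, and one avoiding
    \<open>u\<close> by \<open>c\<close>.\<close>
  define c' where "c' h = (if u \<in> h then \<exists>x \<in> h - {u}. g x else c h)" for h
  obtain x y z where t: "triangle G x y z" "c' {x, y} = c' {y, z}" "c' {y, z} = c' {x, z}"
    using monochromatic_triangle by blast
  have ne: "x \<noteq> y" "y \<noteq> z" "x \<noteq> z"
    using t(1) adjD(1) by (auto simp: triangle_def)
  have sym: "triangle G y x z" "triangle G z x y"
    using t(1) by (auto simp: triangle_def adjacent_commute)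
  consider "u = x" | "u = y" | "u = z" | "u \<notin> {x, y, z}" by blast
  then show False
  proof cases
    case 1
    then have "c' {x, y} = g y" "c' {x, z} = g z" "c' {y, z} = c {y, z}"
      using ne by (auto simp: c'_def)
    then show False using g[of y z] t 1 by simp
  next
    case 2
    then have "c' {x, y} = g x" "c' {y, z} = g z" "c' {x, z} = c {x, z}"
      using ne by (auto simp: c'_def)
    then show False using g[of x z] t sym 2 by simp
  next
    case 3
    then have "c' {x, z} = g x" "c' {y, z} = g y" "c' {x, y} = c {x, y}"
      using ne by (auto simp: c'_def)
    then show False using g[of x y] t sym 3 by simp
  next
    case 4
    then show False
      using c[OF t(1)] t(2,3) by (auto simp: c'_def doubleton_eq_iff)
  qed
qed

end

theorem theorem1:
  fixes G :: "'a graph"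
  assumes "simple_graph G"
    and "free_of co_P2_P3 G"
    and "arrows_33 G"
    and "\<forall>e \<in> edges G. \<not> arrows_33 (delete_edge G e)"
  shows "free_of (complete_graph 4) G
    \<and> ((\<forall>e \<in> edges G. 2 \<le> card {T \<in> copies (complete_graph 3) G. e \<in> edges T})
        \<and> (\<forall>u \<in> verts G. \<forall>v \<in> verts (link G u). 2 \<le> degree (link G u) v))
    \<and> (\<forall>u \<in> verts G. free_of (complete_graph 3) (link G u) \<and> free_of (cycle_graph 4) (link G u))
    \<and> (\<forall>u \<in> verts G.
        (\<forall>e \<in> edges (link G u). \<exists>v \<in> non_neighbors G u. \<forall>x \<in> e. adjacent G v x)
        \<and> (\<forall>e \<in> edges (link G u). \<forall>f \<in> edges (link G u). e \<noteq> f \<longrightarrow>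
             (\<forall>v \<in> non_neighbors G u. \<forall>w \<in> non_neighbors G u.
                (\<forall>x \<in> e. adjacent G v x) \<and> (\<forall>x \<in> f. adjacent G w x) \<longrightarrow> v \<noteq> w)))
    \<and> (\<forall>u \<in> verts G. neighbors G u \<noteq> {} \<longrightarrow> 8 \<le> degree G u)"
proof -
  interpret minimal_arrowing G
    using assms by unfold_locales
  \<comment> \<open>Equality would make a single outer vertex serve two distinct link edges.\<close>
  have distinct: "v \<noteq> w" if "e \<in> edges (link G u)" "f \<in> edges (link G u)" "e \<noteq> f"
    "v \<in> non_neighbors G u" "\<forall>x \<in> e. adjacent G v x" "\<forall>x \<in> f. adjacent G w x" for u e f v w
    using edge_link_common_neighbor_distinct[of e u f v] that by blast
  show ?thesis
    by (intro conjI ballI impI K4_free card_triangles_on_edge degree_link K3_free_link C4_free_link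
        edge_link_common_neighbor degree_ge_8; (assumption | (elim conjE, rule distinct, assumption+)))
qed

end
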